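(* Let $q = r^{1/m}$, where $r > 1$ is a rational number and $m$ is a positive integer such that $q^{m'}$ is irrational for every positive integer $m' < m$. Then for every real $u > 0$ and every integer $n \geq 1$, the geometric progression $\mathcal{G} = \mathcal{G}(u,q)$ satisfies $a(\mathcal{G}^{(n)}) \leq m$, and $a(\mathcal{G}^{(n)}) = m$ whenever $n \geq 2m$.
   Context: For real $v \geq 0$ and $d > 0$, $\mathcal{A}(v,d) := \{v, v+d, v+2d, \ldots\}$ is the arithmetic progression with first term $v$ and common difference $d$. For real $u > 0$ and $q > 1$, $\mathcal{G}(u,q) := \{u, uq, uq^2, \ldots\}$ is the geometric progression with first term $u$ and ratio $q$. For a positive integer $n$, $\mathcal{G}^{(n)}$ denotes the set of the first $n$ terms of $\mathcal{G}$, i.e. $\{u, uq, \ldots, uq^{n-1}\}$. For a finite set $\mathcal{S}$ of nonnegative real numbers, $a(\mathcal{S})$ denotes the least positive integer $h$ such that there exist $h$ arithmetic progressions $\mathcal{A}_1, \ldots, \mathcal{A}_h$ (each of the form $\mathcal{A}(v,d)$ with $v \geq 0$, $d>0$) with $\mathcal{S} \subseteq \bigcup_{i=1}^h \mathcal{A}_i$. *)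

theory Defs
  imports Complex_Main
begin

definition arith_prog :: "real \<Rightarrow> real \<Rightarrow> real set" where
  "arith_prog v d = {v + real k * d | k. True}"

text \<open>The set of the first \<open>n\<close> terms \<open>u, u q, \<dots>, u q^(n-1)\<close> of the geometric
  progression with first term \<open>u\<close> and ratio \<open>q\<close>.\<close>

definition geom_prog_init :: "real \<Rightarrow> real \<Rightarrow> nat \<Rightarrow> real set" where
  "geom_prog_init u q n = {u * q ^ k | k. k < n}"

definition covered_by_aps :: "real set \<Rightarrow> nat \<Rightarrow> bool" where
  "covered_by_aps S h \<longleftrightarrow>
     (\<exists>v d :: nat \<Rightarrow> real. (\<forall>i<h. v i \<ge> 0 \<and> d i > 0) \<and>
        S \<subseteq> (\<Union>i<h. arith_prog (v i) (d i)))"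

text \<open>Meaningful for finite sets of nonnegative reals, where a covering number exists
  (lemma \<open>ap_cover_number_attained\<close>).\<close>

definition ap_cover_number :: "real set \<Rightarrow> nat" where
  "ap_cover_number S = (LEAST h. h > 0 \<and> covered_by_aps S h)"

lemma ap_cover_number_attained:
  assumes "finite S" and "\<forall>x\<in>S. x \<ge> 0"
  shows "ap_cover_number S > 0 \<and> covered_by_aps S (ap_cover_number S)"
proof -
  obtain f :: "nat \<Rightarrow> real" where f: "bij_betw f {0..<card S} S"
    using ex_bij_betw_nat_finite[OF assms(1)] by blast
  define v where "v i = (if i < card S then f i else 0)" for i
  have "v i \<ge> 0" for i
    using assms(2) bij_betwE[OF f] by (auto simp: v_def)
  moreover have "S \<subseteq> (\<Union>i<Suc (card S). arith_prog (v i) 1)"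
  proof
    fix x assume "x \<in> S"
    then obtain i where "i < card S" "x = f i"
      using bij_betw_imp_surj_on[OF f] by force
    then have "i < Suc (card S)" "x = v i + real 0 * 1"
      by (auto simp: v_def)
    then show "x \<in> (\<Union>i<Suc (card S). arith_prog (v i) 1)"
      unfolding arith_prog_def by blast
  qed
  ultimately have "Suc (card S) > 0 \<and> covered_by_aps S (Suc (card S))"
    unfolding covered_by_aps_def
    by (intro conjI exI[of _ v] exI[of _ "\<lambda>_. 1"]) auto
  then show ?thesis
    unfolding ap_cover_number_def by (rule LeastI)
qed

end

theory Submission
  imports Defs "HOL-Computational_Algebra.Fundamental_Theorem_Algebra"
begin

text \<open>Grouping exponents by residue modulo \<open>m\<close> splits the progression into \<open>m\<close> classes; within
  each the ratio is the rational number \<open>r\<close>, so its first terms have a common measure and lie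
  on one arithmetic progression. Conversely, \<open>X ^ m - r\<close> is irreducible over the rationals, so
  \<open>1, q, \<dots>, q ^ (m - 1)\<close> are linearly independent. Three terms with exponents below \<open>2 m\<close> on
  one arithmetic progression would satisfy a nontrivial rational relation
  \<open>N (q ^ b - 1) = M (q ^ a - 1)\<close>, which reduction by \<open>q ^ m = r\<close> excludes. Hence each
  arithmetic progression covers at most two of the first \<open>2 m\<close> terms.\<close>

section \<open>Linear independence of low powers of \<open>q\<close> over the rationals\<close>

text \<open>Vieta: up to sign, the constant coefficient is the leading one times the product of the
  roots with multiplicity.\<close>

lemma norm_coeff_0_roots_on_circle:
  fixes p :: "complex poly"
  assumes roots: "\<And>z. poly p z = 0 \<Longrightarrow> norm z = \<rho>"
  shows "norm (coeff p 0) = norm (lead_coeff p) * \<rho> ^ degree p"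
proof (cases "p = 0")
  case False
  have p: "p = smult (lead_coeff p) (\<Prod>x\<in>#proots p. [:-x, 1:])"
    by (rule complex_poly_decompose_multiset [symmetric])
  have "norm (poly (\<Prod>x\<in>#A. [:-x, 1:]) 0) = \<rho> ^ size A" if "\<forall>x\<in>#A. norm x = \<rho>" for A :: "complex multiset"
    using that by (induction A) (auto simp: norm_mult)
  from this[of "proots p"] have "norm (poly (\<Prod>x\<in>#proots p. [:-x, 1:]) 0) = \<rho> ^ degree p"
    using False roots by (simp add: size_proots_complex)
  moreover have "norm (poly p 0) = norm (lead_coeff p) * norm (poly (\<Prod>x\<in>#proots p. [:-x, 1:]) 0)"
    by (subst p) (simp only: poly_smult norm_mult)
  ultimately show ?thesis
    by (simp add: poly_0_coeff_0)
qed auto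

lemma of_real_of_rat: "of_real (of_rat x) = (of_rat x :: 'a :: real_field)"
  by (cases x) (simp add: of_rat_rat)

lemma norm_of_rat: "norm (of_rat x :: 'a :: real_normed_field) = \<bar>real_of_rat x\<bar>"
  using norm_of_real[of "of_rat x", where 'a = 'a] by (simp only: of_real_of_rat)

text \<open>Rational coefficients allow division with remainder over the rationals; complex
  arguments give access to all conjugates of \<open>q\<close>.\<close>

definition eval_rat_poly :: "rat poly \<Rightarrow> complex \<Rightarrow> complex" where
  "eval_rat_poly p z = poly (map_poly of_rat p) z"

lemma eval_rat_poly_0 [simp]: "eval_rat_poly 0 z = 0"
  by (simp add: eval_rat_poly_def)

lemma eval_rat_poly_pCons [simp]: "eval_rat_poly (pCons c p) z = of_rat c + z * eval_rat_poly p z"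
  by (simp add: eval_rat_poly_def map_poly_pCons)

lemma eval_rat_poly_1 [simp]: "eval_rat_poly 1 z = 1"
  by (simp add: eval_rat_poly_def)

lemma eval_rat_poly_add [simp]: "eval_rat_poly (p + p') z = eval_rat_poly p z + eval_rat_poly p' z"
  by (induction p p' rule: poly_induct2) (simp_all add: of_rat_add algebra_simps)

lemma eval_rat_poly_smult [simp]: "eval_rat_poly (smult c p) z = of_rat c * eval_rat_poly p z"
  by (induction p) (simp_all add: of_rat_mult algebra_simps)

lemma eval_rat_poly_mult [simp]: "eval_rat_poly (p * p') z = eval_rat_poly p z * eval_rat_poly p' z"
  by (induction p) (simp_all add: algebra_simps)

lemma eval_rat_poly_diff [simp]: "eval_rat_poly (p - p') z = eval_rat_poly p z - eval_rat_poly p' z"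
  using eval_rat_poly_add[of "p - p'" p' z] by (simp del: eval_rat_poly_add)

lemma eval_rat_poly_monom [simp]: "eval_rat_poly (monom c k) z = of_rat c * z ^ k"
  by (simp add: eval_rat_poly_def map_poly_monom poly_monom)

text \<open>All complex roots of \<open>X ^ m - r\<close> have modulus \<open>q\<close>. If the minimal polynomial of \<open>q\<close> had
  degree \<open>d < m\<close>, it would divide \<open>X ^ m - r\<close>, and its constant term would exhibit \<open>q ^ d\<close> as a
  rational number.\<close>

lemma rat_poly_root_degree:
  fixes q :: real and r :: rat and p :: "rat poly"
  assumes q: "q > 0" "q ^ m = of_rat r"
    and irr: "\<And>k. 0 < k \<Longrightarrow> k < m \<Longrightarrow> q ^ k \<notin> \<rat>"
    and p: "degree p < m" "eval_rat_poly p (of_real q) = 0"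
  shows "p = 0"
proof (rule ccontr)
  assume "p \<noteq> 0"
  define P where "P g \<longleftrightarrow> g \<noteq> 0 \<and> eval_rat_poly g (of_real q) = 0" for g
  \<comment> \<open>Up to a scalar, \<open>g\<close> is the minimal polynomial of
    \<open>q\<close>.\<close>
  obtain g where g: "P g" and least: "\<And>h. P h \<Longrightarrow> degree g \<le> degree h"
    using ex_has_least_nat[of P p degree] p \<open>p \<noteq> 0\<close> unfolding P_def by blast
  have gm: "degree g < m"
    using least[of p] p \<open>p \<noteq> 0\<close> by (simp add: P_def)
  have r: "complex_of_real q ^ m = of_rat r"
    using q(2) by (metis of_real_of_rat of_real_power)
  define f where "f = monom 1 m - [:r:]"
  have f: "eval_rat_poly f z = z ^ m - of_rat r" for z
    by (simp add: f_def)
  have g0: "g \<noteq> 0" "eval_rat_poly g (of_real q) = 0"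
    using g by (auto simp: P_def)
  have "eval_rat_poly (f mod g) (of_real q) = 0"
    using f r g0 eval_rat_poly_add[of "g * (f div g)" "f mod g" "of_real q"]
    by (simp del: eval_rat_poly_add)
  then have "f mod g = 0"
    using least[of "f mod g"] degree_mod_less'[OF g0(1), of f] unfolding P_def
    by (meson not_less)
  then have fg: "f = g * (f div g)"
    by (metis dvd_eq_mod_eq_0 dvd_mult_div_cancel)
  define G :: "complex poly" where "G = map_poly of_rat g"
  have G: "degree G = degree g" "coeff G (degree g) = of_rat (lead_coeff g)"
    "coeff G 0 = of_rat (coeff g 0)"
    by (simp_all add: G_def coeff_map_poly degree_map_poly)
  \<comment> \<open>Every root of \<open>g\<close> is a root of its multiple
    \<open>X ^ m - r\<close>.\<close>
  have "norm z = q" if "poly G z = 0" for z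
  proof -
    have "eval_rat_poly g z = 0" using that by (simp add: G_def eval_rat_poly_def)
    then have "z ^ m = complex_of_real q ^ m"
      using f[of z] r fg by (metis eval_rat_poly_mult mult_zero_left eq_iff_diff_eq_0)
    then have "norm z ^ m = q ^ m"
      using q(1) by (metis norm_of_real norm_power abs_of_pos)
    then show ?thesis
      using q(1) gm by (metis power_eq_imp_eq_base norm_ge_zero less_imp_le gr_implies_not0 neq0_conv)
  qed
  then have "norm (coeff G 0) = norm (lead_coeff G) * q ^ degree G"
    by (rule norm_coeff_0_roots_on_circle)
  then have "\<bar>real_of_rat (coeff g 0)\<bar> = \<bar>real_of_rat (lead_coeff g)\<bar> * q ^ degree g"
    by (simp add: G norm_of_rat)
  moreover have "\<bar>real_of_rat (lead_coeff g)\<bar> \<noteq> 0"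
    using g0(1) by simp
  ultimately have "q ^ degree g = \<bar>real_of_rat (coeff g 0)\<bar> / \<bar>real_of_rat (lead_coeff g)\<bar>"
    by (metis nonzero_mult_div_cancel_left)
  moreover have "\<bar>real_of_rat (coeff g 0)\<bar> / \<bar>real_of_rat (lead_coeff g)\<bar> \<in> \<rat>"
    by (intro Rats_divide) simp_all
  ultimately have "q ^ degree g \<in> \<rat>" by simp
  \<comment> \<open>\<open>irr\<close> speaks of positive exponents only; a nonzero constant has no
    root.\<close>
  moreover have "degree g > 0"
  proof (rule ccontr)
    assume "\<not> degree g > 0"
    then obtain c where "g = [:c:]" by (auto elim: degree_eq_zeroE)
    with g0 show False by simp
  qed
  ultimately show False using irr gm by blast
qed

section \<open>At most two of the first \<open>2 m\<close> terms on one arithmetic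
  progression\<close>

lemma no_three_terms_in_arith_prog:
  fixes q :: real and r N M :: rat
  assumes q: "q > 1" "q ^ m = of_rat r"
    and irr: "\<And>k. 0 < k \<Longrightarrow> k < m \<Longrightarrow> q ^ k \<notin> \<rat>"
    and ab: "0 < a" "a < b" "b < 2 * m"
    and NM: "N \<noteq> 0" "M \<noteq> 0"
  shows "of_rat N * (q ^ b - 1) \<noteq> of_rat M * (q ^ a - 1)"
proof
  assume eq: "of_rat N * (q ^ b - 1) = of_rat M * (q ^ a - 1)"
  have m: "m > 0" using ab by simp
  then have "q ^ m > 1" using q(1) by simp
  then have r: "r > 1" using q(2) by simp
  txt \<open>\<open>red e\<close> represents \<open>q ^ e\<close> by a polynomial of degree below \<open>m\<close> (for \<open>e < 2 m\<close>).\<close>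
  define red where "red e = (if e < m then monom 1 e else monom r (e - m))" for e
  have "eval_rat_poly (red e) (of_real q) = of_real (q ^ e)" if "e < 2 * m" for e
  proof (cases "e < m")
    case False
    then have "q ^ e = of_rat r * q ^ (e - m)"
      by (simp flip: q(2) power_add)
    then show ?thesis using False by (simp add: red_def of_real_of_rat)
  qed (simp add: red_def)
  moreover define p where "p = smult N (red b - 1) - smult M (red a - 1)"
  ultimately have "eval_rat_poly p (of_real q)
      = of_real (of_rat N * (q ^ b - 1) - of_rat M * (q ^ a - 1))"
    using ab by (simp add: of_real_of_rat)
  then have "eval_rat_poly p (of_real q) = 0" by (simp add: eq)
  moreover have "degree (red e) < m" if "e < 2 * m" for e
    using that m by (auto simp: red_def intro: le_less_trans[OF degree_monom_le])
  then have "degree p < m"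
    unfolding p_def using m ab
    by (intro degree_diff_less le_less_trans[OF degree_smult_le]) auto
  ultimately have "p = 0"
    using rat_poly_root_degree[of q m r p] q irr by simp
  then have c: "N * (coeff (red b) k - coeff 1 k) = M * (coeff (red a) k - coeff 1 k)" for k
    unfolding p_def by (metis coeff_0 coeff_diff coeff_smult eq_iff_diff_eq_0)
  \<comment> \<open>A positive exponent occurring in just one of the two reduced powers forces
    \<open>N = 0\<close> or \<open>M = 0\<close>: \<open>b\<close> in the first case,
    \<open>a\<close> in the second, \<open>b - m\<close> in the last. When \<open>b = a + m\<close>
    both reduce to exponent \<open>a\<close>; then the constant terms give \<open>N = M\<close> and
    the coefficients at \<open>a\<close> give \<open>N * r = M\<close>, against
    \<open>r > 1\<close>.\<close>
  consider "b < m" | "b = m" | "b > m" "b = a + m" | "b > m" "b \<noteq> a + m" by linarith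
  then show False
  proof cases
    case 1
    then show False using c[of b] ab NM by (simp add: red_def)
  next
    case 2
    then show False using c[of a] ab NM by (simp add: red_def)
  next
    case 3
    then have "a < m" using ab by simp
    then show False using c[of 0] c[of a] 3 ab NM r by (simp add: red_def)
  next
    case 4
    then show False using c[of "b - m"] ab NM r
      by (auto simp: red_def split: if_splits)
  qed
qed

text \<open>An element other than the minimum and the maximum lies strictly between them. Ordered
  triples allow the smallest power of \<open>q\<close> to be factored out later.\<close>

lemma card_le_2_no_three_ordered:
  fixes S :: "nat set"
  assumes "finite S" and "\<And>i j k. \<lbrakk>i \<in> S; j \<in> S; k \<in> S; i < j; j < k\<rbrakk> \<Longrightarrow> False"
  shows "card S \<le> 2"
proof (rule ccontr)
  assume "\<not> card S \<le> 2"
  then have "S \<noteq> {}" "card S > 2" by auto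
  moreover have "S \<subseteq> {Min S, Max S}"
  proof
    fix j assume "j \<in> S"
    then show "j \<in> {Min S, Max S}"
      using assms Min_in[of S] Max_in[of S] Min_le[of S j] Max_ge[of S j]
      by (metis insert_iff le_neq_implies_less empty_iff)
  qed
  then have "card S \<le> card {Min S, Max S}"
    by (intro card_mono) auto
  ultimately show False
    using card_insert_le_m1[of 2 "{Max S}" "Min S"] by auto
qed

section \<open>Upper and lower bounds for the covering number\<close>

lemma geom_prog_init_covered:
  fixes q u :: real and r :: rat
  assumes "q > 0" "q ^ m = of_rat r" "m > 0" "u > 0" "r > 0"
  shows "covered_by_aps (geom_prog_init u q n) m"
proof -
  obtain x y :: int where xy: "y > 0" "r = of_int x / of_int y"
    using quotient_of_div quotient_of_denom_pos by (metis surj_pair)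
  with \<open>r > 0\<close> have x: "x > 0" by (simp add: zero_less_divide_iff)
  \<comment> \<open>The factor \<open>y ^ n\<close> clears the denominator of every
    \<open>r ^ j\<close> with \<open>j \<le> n\<close>, so each term of the class of
    \<open>i\<close> is an integer multiple of \<open>d i\<close>.\<close>
  define d where "d i = u * q ^ i / of_int y ^ n" for i
  have "u * q ^ k \<in> arith_prog 0 (d (k mod m))" if "k < n" for k
  proof -
    define j where "j = k div m"
    have j: "j \<le> n" using that unfolding j_def by (meson div_le_dividend le_trans less_imp_le)
    have "q ^ k = (q ^ m) ^ j * q ^ (k mod m)"
      by (simp add: j_def flip: power_mult power_add)
    also have "q ^ m = of_int x / of_int y"
      by (simp add: assms(2) xy of_rat_divide)
    also have "(of_int x / of_int y :: real) ^ j = of_int (x ^ j * y ^ (n - j)) / of_int y ^ n"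
      using xy(1) j by (simp add: field_simps flip: power_add)
    finally have "u * q ^ k = of_int (x ^ j * y ^ (n - j)) * d (k mod m)"
      by (simp add: d_def)
    also have "\<dots> = 0 + real (nat (x ^ j * y ^ (n - j))) * d (k mod m)"
      using x xy(1) by simp
    finally show ?thesis unfolding arith_prog_def by blast
  qed
  then have "geom_prog_init u q n \<subseteq> (\<Union>i<m. arith_prog 0 (d i))"
    using \<open>m > 0\<close> by (force simp: geom_prog_init_def)
  moreover have "d i > 0" for i
    using assms xy by (simp add: d_def)
  ultimately show ?thesis
    unfolding covered_by_aps_def by (intro exI[of _ "\<lambda>_. 0"] exI[of _ d]) auto
qed

lemma geom_prog_init_covered_ge:
  fixes q u :: real and r :: rat
  assumes q: "q > 1" "q ^ m = of_rat r"
    and irr: "\<And>k. 0 < k \<Longrightarrow> k < m \<Longrightarrow> q ^ k \<notin> \<rat>"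
    and u: "u > 0" and n: "2 * m \<le> n"
    and cov: "covered_by_aps (geom_prog_init u q n) h"
  shows "m \<le> h"
proof -
  obtain v d where d: "\<And>i. i < h \<Longrightarrow> d i > 0"
    and sub: "geom_prog_init u q n \<subseteq> (\<Union>i<h. arith_prog (v i) (d i))"
    using cov unfolding covered_by_aps_def by blast
  \<comment> \<open>Exponents, not terms, are counted, and only those below \<open>2 * m\<close>,
    where one reduction by \<open>q ^ m = r\<close> suffices.\<close>
  define I where "I l = {k. k < 2 * m \<and> u * q ^ k \<in> arith_prog (v l) (d l)}" for l
  have "{..<2 * m} \<subseteq> (\<Union>l<h. I l)"
  proof
    fix k assume "k \<in> {..<2 * m}"
    moreover from this have "u * q ^ k \<in> geom_prog_init u q n"
      using n unfolding geom_prog_init_def by fastforce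
    ultimately show "k \<in> (\<Union>l<h. I l)" using sub by (auto simp: I_def)
  qed
  then have "2 * m \<le> card (\<Union>l<h. I l)"
    using card_mono[of "\<Union>l<h. I l" "{..<2 * m}"] by (simp add: I_def)
  also have "\<dots> \<le> (\<Sum>l<h. card (I l))" by (rule card_UN_le) simp
  also have "\<dots> \<le> (\<Sum>l<h. 2)"
  proof (intro sum_mono card_le_2_no_three_ordered)
    fix l assume "l \<in> {..<h}"
    show "finite (I l)" by (simp add: I_def)
    fix i j k assume I: "i \<in> I l" "j \<in> I l" "k \<in> I l" and ijk: "i < j" "j < k"
    then obtain a b c where abc: "u * q ^ i = v l + real a * d l" "u * q ^ j = v l + real b * d l"
      "u * q ^ k = v l + real c * d l"
      unfolding I_def arith_prog_def by blast
    \<comment> \<open>The smallest of the three terms in units of \<open>d l\<close>: multiplying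
      \<open>q ^ (j - i) - 1\<close> and \<open>q ^ (k - i) - 1\<close> by \<open>e\<close> gives
      integers, and \<open>e\<close> cancels from their proportion.\<close>
    define e where "e = u * q ^ i / d l"
    have dl: "d l > 0" using d \<open>l \<in> {..<h}\<close> by simp
    have e: "e > 0" using dl u q by (simp add: e_def)
    have "q ^ j = q ^ i * q ^ (j - i)" "q ^ k = q ^ i * q ^ (k - i)"
      using ijk by (simp_all flip: power_add)
    then have "e * (q ^ (j - i) - 1) = (u * q ^ j - u * q ^ i) / d l"
      "e * (q ^ (k - i) - 1) = (u * q ^ k - u * q ^ i) / d l"
      by (simp_all add: e_def field_simps)
    then have diff: "e * (q ^ (j - i) - 1) = real b - real a"
      "e * (q ^ (k - i) - 1) = real c - real a"
      using dl by (simp_all add: abc flip: left_diff_distrib)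
    have gt: "q ^ (j - i) > 1" "q ^ (k - i) > 1"
      using q ijk by simp_all
    then have "e * (q ^ (j - i) - 1) > 0" "e * (q ^ (k - i) - 1) > 0"
      using e by simp_all
    then have ne: "b \<noteq> a" "c \<noteq> a" using diff by auto
    have "e * ((real b - real a) * (q ^ (k - i) - 1)) = e * ((real c - real a) * (q ^ (j - i) - 1))"
      by (simp flip: diff)
    then have "of_rat (of_nat b - of_nat a) * (q ^ (k - i) - 1)
        = of_rat (of_nat c - of_nat a) * (q ^ (j - i) - 1)"
      using e by (simp add: of_rat_diff)
    moreover have "k < 2 * m" using I by (simp add: I_def)
    ultimately show False
      using no_three_terms_in_arith_prog[OF q irr, of "j - i" "k - i" "of_nat b - of_nat a"
          "of_nat c - of_nat a"] ijk ne by auto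
  qed
  finally show ?thesis by simp
qed

theorem theorem1p2:
  fixes q r u :: real and m n :: nat
  assumes "r \<in> \<rat>" and "r > 1" and "m > 0"
    and "q = r powr (1 / real m)"
    and "\<And>m'. 0 < m' \<Longrightarrow> m' < m \<Longrightarrow> q ^ m' \<notin> \<rat>"
    and "u > 0" and "n \<ge> 1"
  shows "ap_cover_number (geom_prog_init u q n) \<le> m
    \<and> (n \<ge> 2 * m \<longrightarrow> ap_cover_number (geom_prog_init u q n) = m)"
proof -
  obtain r' where r': "r = of_rat r'" using \<open>r \<in> \<rat>\<close> by (auto elim: Rats_cases)
  have q1: "q > 1"
    unfolding assms(4) using \<open>m > 0\<close> \<open>r > 1\<close> by simp
  have "q ^ m = q powr real m" using q1 by (simp add: powr_realpow)
  also have "\<dots> = r"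
    unfolding assms(4) powr_powr using \<open>m > 0\<close> \<open>r > 1\<close> by simp
  finally have qm: "q ^ m = of_rat r'" by (simp only: r')
  have "r' > 1" using \<open>r > 1\<close> by (simp add: r')
  then have "r' > 0" by simp
  then have "covered_by_aps (geom_prog_init u q n) m"
    using geom_prog_init_covered q1 qm assms by simp
  then have le: "ap_cover_number (geom_prog_init u q n) \<le> m"
    unfolding ap_cover_number_def using \<open>m > 0\<close> by (intro Least_le) simp
  \<comment> \<open>These conditions ensure that the least number is attained by an actual cover, to
    which the lower bound applies.\<close>
  have "finite (geom_prog_init u q n)" "\<forall>x\<in>geom_prog_init u q n. x \<ge> 0"
    using q1 \<open>u > 0\<close> by (auto simp: geom_prog_init_def)
  then have "covered_by_aps (geom_prog_init u q n) (ap_cover_number (geom_prog_init u q n))"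
    using ap_cover_number_attained by blast
  then have "m \<le> ap_cover_number (geom_prog_init u q n)" if "n \<ge> 2 * m"
    using geom_prog_init_covered_ge[OF q1 qm assms(5) \<open>u > 0\<close> that] by blast
  with le show ?thesis by (auto intro: antisym)
qed

end
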